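(* For every $q\ge p_->2$ and $r\in\mathbb R$, $$|r|^q\left(\frac{q-p_-}{q}\log|r|+\frac{p_-}{q^2}\right)\ge -c_{p_-}(q),$$ where the expression at $r=0$ is defined by continuity. For each fixed $q$, $c_{p_-}(q)$ is the smallest nonnegative constant for which this inequality holds for all $r\in\mathbb R$. Consequently, under (H1) and (H2), every energy solution $u$ of (P) satisfies, at every time $t$ of its existence interval, $$\int_\Omega|u|^{p(x)}\log|u|\,dx\ge\frac{p_-}{2}\|u_t\|_2^2+\frac{p_-}{2}\left(1-\int_0^tg(s)\,ds\right)\|\nabla u\|_2^2+\frac{p_-}{2}(g\circ\nabla u)(t)-p_-\mathcal E(t).$$
   Context: For $q\ge p_-$: $c_{p_-}(q)=\frac{q-p_-}{q^2}e^{-q/(q-p_-)}$ if $q>p_-$ and $c_{p_-}(p_-)=0$. (In the first two assertions $p_->2$ is any real number.) Setting. $n\ge1$ and $\Omega\subset\mathbb R^n$ is a bounded domain with smooth boundary; $V=H_0^1(\Omega)$ with $\|z\|_V=\|\nabla z\|_2$; $H=L^2(\Omega)$; $\|\cdot\|_2$ and $(\cdot,\cdot)$ are the $L^2(\Omega)$ norm and inner product; $\langle\cdot,\cdot\rangle$ is the pairing of $V^*$ and $V$. (H1): $p:\Omega\to\mathbb R$ is measurable and $2<p_-:=\operatorname{ess\,inf}_\Omega p\le p(x)\le p_+:=\operatorname{ess\,sup}_\Omega p<2^*$ for a.e. $x$, where $2^*=2n/(n-2)$ if $n\ge3$ and $2^*=\infty$ if $n\le2$. (H2): $g\in C^1([0,\infty))$,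 $g\ge0$, $g'\le0$, and $\ell:=1-\int_0^\infty g(s)\,ds>0$. Problem (P): $u_{tt}-\Delta u+\int_0^t g(t-s)\Delta u(s)\,ds-\Delta u_t=|u|^{p(x)-2}u\log|u|$ in $\Omega\times(0,\infty)$, $u=0$ on $\partial\Omega\times(0,\infty)$, $u(0)=u_0$, $u_t(0)=u_1$; the source, and $|u|^{p(x)}\log|u|$, are $0$ at $u=0$. For $(u_0,u_1)\in V\times H$, an energy solution on $[0,T]$ is $u\in C([0,T];V)$ with $u_t\in C([0,T];H)\cap L^2(0,T;V)$, $u_{tt}\in L^2(0,T;V^* )$, $u(0)=u_0$, $u_t(0)=u_1$, such that for every $z\in V$ and a.e. $t\in(0,T)$: $\langle u_{tt},z\rangle+(\nabla u,\nabla z)+(\nabla u_t,\nabla z)-\int_0^tg(t-s)(\nabla u(s),\nabla z)\,ds=\int_\Omega|u|^{p(x)-2}u\log|u|\,z\,dx$. Energies. $F(x,r)=\frac{|r|^{p(x)}}{p(x)}\log|r|-\frac{|r|^{p(x)}}{p(x)^2}$, $F(x,0)=0$; $(g\circ\nabla u)(t)=\int_0^tg(t-s)\|\nabla u(t)-\nabla u(s)\|_2^2\,ds$; $$E(t)=\tfrac12\|u_t(t)\|_2^2+\tfrac12\Big(1-\int_0^tg(s)\,ds\Big)\|\nabla u(t)\|_2^2+\tfrac12(g\circ\nabla u)(t)-\int_\Omega F(x,u(t))\,dx.$$ $C_*=\int_\Omega c_{p_-}(p(x))\,dx$ (finite). The shifted energy is $\mathcal E(t)=E(t)+C_*/p_-$.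 *)

theory Defs
  imports "HOL-Analysis.Analysis" "HOL-Probability.Essential_Supremum"
begin

section \<open>The pointwise lower bound\<close>

definition c_const :: "real \<Rightarrow> real \<Rightarrow> real" where
  "c_const pm q = (if q > pm then (q - pm) / q\<^sup>2 * exp (- q / (q - pm)) else 0)"

definition raw_expr :: "real \<Rightarrow> real \<Rightarrow> real \<Rightarrow> real" where
  "raw_expr pm q r = \<bar>r\<bar> powr q * ((q - pm) / q * ln \<bar>r\<bar> + pm / q\<^sup>2)"

definition lower_expr :: "real \<Rightarrow> real \<Rightarrow> real \<Rightarrow> real" where
  "lower_expr pm q r = (if r = 0 then Lim (at 0) (raw_expr pm q) else raw_expr pm q r)"


section \<open>Smooth functions, test functions, domains with smooth boundary\<close>

primrec Ck_function :: "nat \<Rightarrow> ('a::euclidean_space \<Rightarrow> real) \<Rightarrow> bool" where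
  "Ck_function 0 f \<longleftrightarrow> continuous_on UNIV f"
| "Ck_function (Suc k) f \<longleftrightarrow> (\<forall>x. f differentiable (at x)) \<and>
     (\<forall>b\<in>Basis. Ck_function k (\<lambda>x. frechet_derivative f (at x) b))"

definition smooth_function :: "('a::euclidean_space \<Rightarrow> real) \<Rightarrow> bool" where
  "smooth_function f \<longleftrightarrow> (\<forall>k. Ck_function k f)"

definition test_function :: "'a::euclidean_space set \<Rightarrow> ('a \<Rightarrow> real) \<Rightarrow> bool" where
  "test_function \<Omega> \<phi> \<longleftrightarrow> smooth_function \<phi> \<and>
     compact (closure {x. \<phi> x \<noteq> 0}) \<and> closure {x. \<phi> x \<noteq> 0} \<subseteq> \<Omega>"

definition grad :: "('a::euclidean_space \<Rightarrow> real) \<Rightarrow> 'a \<Rightarrow> 'a" where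
  "grad \<phi> x = (\<Sum>b\<in>Basis. frechet_derivative \<phi> (at x) b *\<^sub>R b)"

text \<open>
  Near each boundary point, up to relabelling and reorienting the coordinate axes, the domain is
  the part of a ball above the graph of a smooth function of the remaining \<open>n - 1\<close> coordinates.
  Such a function is represented by a function \<open>\<gamma>\<close> on the whole space that is constant
  in the direction of the distinguished axis \<open>b\<close>.
\<close>
definition smooth_boundary :: "'a::euclidean_space set \<Rightarrow> bool" where
  "smooth_boundary \<Omega> \<longleftrightarrow> (\<forall>x0\<in>frontier \<Omega>. \<exists>r>0. \<exists>b\<in>Basis. \<exists>\<sigma>\<in>{-1, 1::real}. \<exists>\<gamma>.
     smooth_function \<gamma> \<and> (\<forall>x c. \<gamma> (x + c *\<^sub>R b) = \<gamma> x) \<and>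
     \<Omega> \<inter> ball x0 r = {x \<in> ball x0 r. \<sigma> * (x \<bullet> b) > \<gamma> x})"

definition smooth_bounded_domain :: "'a::euclidean_space set \<Rightarrow> bool" where
  "smooth_bounded_domain \<Omega> \<longleftrightarrow>
     \<Omega> \<noteq> {} \<and> open \<Omega> \<and> connected \<Omega> \<and> bounded \<Omega> \<and> smooth_boundary \<Omega>"


section \<open>\<open>H = L\<^sup>2(\<Omega>)\<close>, \<open>V = H\<^sub>0\<^sup>1(\<Omega>)\<close> and the dual of \<open>V\<close>\<close>

text \<open>
  Elements of these spaces are represented by functions on the whole space, of which only the
  restriction to \<open>\<Omega>\<close> matters, and only up to equality almost everywhere.
\<close>

definition L2 :: "'a::euclidean_space set \<Rightarrow> ('a \<Rightarrow> 'b::euclidean_space) set" where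
  "L2 \<Omega> = {f. f \<in> borel_measurable (lebesgue_on \<Omega>) \<and>
              integrable (lebesgue_on \<Omega>) (\<lambda>x. (norm (f x))\<^sup>2)}"

definition L2norm :: "'a::euclidean_space set \<Rightarrow> ('a \<Rightarrow> 'b::euclidean_space) \<Rightarrow> real" where
  "L2norm \<Omega> f = sqrt (LINT x|lebesgue_on \<Omega>. (norm (f x))\<^sup>2)"

definition L2inner ::
    "'a::euclidean_space set \<Rightarrow> ('a \<Rightarrow> 'b::euclidean_space) \<Rightarrow> ('a \<Rightarrow> 'b) \<Rightarrow> real" where
  "L2inner \<Omega> f h = (LINT x|lebesgue_on \<Omega>. f x \<bullet> h x)"

definition weak_gradient ::
    "'a::euclidean_space set \<Rightarrow> ('a \<Rightarrow> real) \<Rightarrow> ('a \<Rightarrow> 'a) \<Rightarrow> bool" where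
  "weak_gradient \<Omega> f G \<longleftrightarrow> (\<forall>\<phi>. test_function \<Omega> \<phi> \<longrightarrow> (\<forall>b\<in>Basis.
     (LINT x|lebesgue_on \<Omega>. f x * (grad \<phi> x \<bullet> b)) =
     - (LINT x|lebesgue_on \<Omega>. (G x \<bullet> b) * \<phi> x)))"

definition H1 :: "'a::euclidean_space set \<Rightarrow> ('a \<Rightarrow> real) set" where
  "H1 \<Omega> = {f \<in> L2 \<Omega>. \<exists>G\<in>L2 \<Omega>. weak_gradient \<Omega> f G}"

text \<open>A representative of the weak gradient, which is unique up to null sets on \<^term>\<open>H1 \<Omega>\<close>.\<close>
definition wgrad :: "'a::euclidean_space set \<Rightarrow> ('a \<Rightarrow> real) \<Rightarrow> 'a \<Rightarrow> 'a" where
  "wgrad \<Omega> f = (SOME G. G \<in> L2 \<Omega> \<and> weak_gradient \<Omega> f G)"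

text \<open>The closure of the test functions in \<^term>\<open>H1 \<Omega>\<close>.\<close>
definition H01 :: "'a::euclidean_space set \<Rightarrow> ('a \<Rightarrow> real) set" where
  "H01 \<Omega> = {f \<in> H1 \<Omega>. \<exists>\<phi> :: nat \<Rightarrow> 'a \<Rightarrow> real. (\<forall>k. test_function \<Omega> (\<phi> k)) \<and>
     (\<lambda>k. L2norm \<Omega> (\<lambda>x. \<phi> k x - f x)) \<longlonglongrightarrow> 0 \<and>
     (\<lambda>k. L2norm \<Omega> (\<lambda>x. grad (\<phi> k) x - wgrad \<Omega> f x)) \<longlonglongrightarrow> 0}"

definition Vnorm :: "'a::euclidean_space set \<Rightarrow> ('a \<Rightarrow> real) \<Rightarrow> real" where
  "Vnorm \<Omega> z = L2norm \<Omega> (wgrad \<Omega> z)"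

text \<open>
  Functionals are represented by maps on all functions, of which only the restriction to
  \<^term>\<open>H01 \<Omega>\<close> matters.  Boundedness makes them respect equality almost everywhere.
\<close>
definition Vdual :: "'a::euclidean_space set \<Rightarrow> (('a \<Rightarrow> real) \<Rightarrow> real) set" where
  "Vdual \<Omega> = {L.
     (\<forall>z\<in>H01 \<Omega>. \<forall>w\<in>H01 \<Omega>. \<forall>\<alpha> \<beta>. L (\<lambda>x. \<alpha> * z x + \<beta> * w x) = \<alpha> * L z + \<beta> * L w) \<and>
     (\<exists>C. \<forall>z\<in>H01 \<Omega>. \<bar>L z\<bar> \<le> C * Vnorm \<Omega> z)}"

definition Vdual_norm :: "'a::euclidean_space set \<Rightarrow> (('a \<Rightarrow> real) \<Rightarrow> real) \<Rightarrow> real" where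
  "Vdual_norm \<Omega> L = Sup {\<bar>L z\<bar> | z. z \<in> H01 \<Omega> \<and> Vnorm \<Omega> z \<le> 1}"


section \<open>Functions of time with values in a space of functions\<close>

text \<open>
  A (semi)normed space is given by a set \<open>X\<close> of real-valued functions and a (semi)norm \<open>N\<close> on it.
  For the dual of \<open>V\<close> these functions are functionals.
\<close>

definition continuous_into ::
    "real set \<Rightarrow> ('c \<Rightarrow> real) set \<Rightarrow> (('c \<Rightarrow> real) \<Rightarrow> real) \<Rightarrow> (real \<Rightarrow> 'c \<Rightarrow> real) \<Rightarrow> bool" where
  "continuous_into I X N f \<longleftrightarrow> (\<forall>t\<in>I. f t \<in> X) \<and>
     (\<forall>t\<in>I. ((\<lambda>s. N (\<lambda>c. f s c - f t c)) \<longlongrightarrow> 0) (at t within I))"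

definition strongly_measurable_into ::
    "real set \<Rightarrow> ('c \<Rightarrow> real) set \<Rightarrow> (('c \<Rightarrow> real) \<Rightarrow> real) \<Rightarrow> (real \<Rightarrow> 'c \<Rightarrow> real) \<Rightarrow> bool" where
  "strongly_measurable_into I X N f \<longleftrightarrow> (\<exists>s :: nat \<Rightarrow> real \<Rightarrow> 'c \<Rightarrow> real.
     (\<forall>k. finite (s k ` I) \<and> s k ` I \<subseteq> X \<and> (\<forall>y. {t\<in>I. s k t = y} \<in> sets lebesgue)) \<and>
     (AE t in lebesgue_on I. (\<lambda>k. N (\<lambda>c. s k t c - f t c)) \<longlonglongrightarrow> 0))"

definition square_integrable_into ::
    "real set \<Rightarrow> ('c \<Rightarrow> real) set \<Rightarrow> (('c \<Rightarrow> real) \<Rightarrow> real) \<Rightarrow> (real \<Rightarrow> 'c \<Rightarrow> real) \<Rightarrow> bool" where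
  "square_integrable_into I X N f \<longleftrightarrow> (AE t in lebesgue_on I. f t \<in> X) \<and>
     strongly_measurable_into I X N f \<and> integrable (lebesgue_on I) (\<lambda>t. (N (f t))\<^sup>2)"

text \<open>
  The distributional derivative on \<open>(0,T)\<close> of a function with values in a dual space, given
  through its pairings with the elements \<open>z\<close> of the predual \<open>Z\<close>.  Bochner integrals commute with
  these pairings, so this is the identity \<open>\<integral> a \<phi>' = - \<integral> b \<phi>\<close> of dual-valued Bochner integrals.
\<close>
definition weak_time_deriv ::
    "real \<Rightarrow> 'z set \<Rightarrow> (real \<Rightarrow> 'z \<Rightarrow> real) \<Rightarrow> (real \<Rightarrow> 'z \<Rightarrow> real) \<Rightarrow> bool" where
  "weak_time_deriv T Z a b \<longleftrightarrow> (\<forall>z\<in>Z. \<forall>\<phi>. test_function {0<..<T} \<phi> \<longrightarrow>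
     (LINT t|lebesgue_on {0<..<T}. a t z * deriv \<phi> t) =
     - (LINT t|lebesgue_on {0<..<T}. b t z * \<phi> t))"


section \<open>Assumptions on the exponent and on the memory kernel\<close>

definition essinf :: "'a measure \<Rightarrow> ('a \<Rightarrow> ereal) \<Rightarrow> ereal" where
  "essinf M f = - esssup M (\<lambda>x. - f x)"

definition p_minus :: "'a::euclidean_space set \<Rightarrow> ('a \<Rightarrow> real) \<Rightarrow> real" where
  "p_minus \<Omega> p = real_of_ereal (essinf (lebesgue_on \<Omega>) (\<lambda>x. ereal (p x)))"

definition sobolev_critical :: "nat \<Rightarrow> ereal" where
  "sobolev_critical n = (if n \<ge> 3 then ereal (2 * real n / (real n - 2)) else \<infinity>)"

definition exponent_hyp :: "'a::euclidean_space set \<Rightarrow> ('a \<Rightarrow> real) \<Rightarrow> bool" where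
  "exponent_hyp \<Omega> p \<longleftrightarrow> p \<in> borel_measurable (lebesgue_on \<Omega>) \<and>
     2 < essinf (lebesgue_on \<Omega>) (\<lambda>x. ereal (p x)) \<and>
     (AE x in lebesgue_on \<Omega>.
        essinf (lebesgue_on \<Omega>) (\<lambda>x. ereal (p x)) \<le> ereal (p x) \<and>
        ereal (p x) \<le> esssup (lebesgue_on \<Omega>) (\<lambda>x. ereal (p x))) \<and>
     esssup (lebesgue_on \<Omega>) (\<lambda>x. ereal (p x)) < sobolev_critical DIM('a)"

text \<open>
  Positivity of \<open>1 - \<integral> g\<close> presupposes that \<open>g\<close> is integrable; this has to be said explicitly, as
  the Bochner integral of a non-integrable function is 0.
\<close>
definition kernel_hyp :: "(real \<Rightarrow> real) \<Rightarrow> bool" where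
  "kernel_hyp g \<longleftrightarrow>
     (\<exists>g'. continuous_on {0..} g' \<and>
        (\<forall>s\<ge>0. (g has_real_derivative g' s) (at s within {0..}) \<and> g' s \<le> 0)) \<and>
     (\<forall>s\<ge>0. g s \<ge> 0) \<and>
     integrable (lebesgue_on {0..}) g \<and> 1 - (LINT s|lebesgue_on {0..}. g s) > 0"


section \<open>Energy solutions\<close>

text \<open>
  The conventions at \<open>r = 0\<close> for the source, for \<open>|r|\<^sup>p log|r|\<close> and for the potential are built
  in, since \<open>0 powr a = 0\<close>.
\<close>
definition source :: "('a \<Rightarrow> real) \<Rightarrow> 'a \<Rightarrow> real \<Rightarrow> real" where
  "source p x r = \<bar>r\<bar> powr (p x - 2) * r * ln \<bar>r\<bar>"

definition F_pot :: "('a \<Rightarrow> real) \<Rightarrow> 'a \<Rightarrow> real \<Rightarrow> real" where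
  "F_pot p x r = \<bar>r\<bar> powr p x / p x * ln \<bar>r\<bar> - \<bar>r\<bar> powr p x / (p x)\<^sup>2"

text \<open>
  In \<open>energy_solution \<Omega> p g u0 u1 T u ut\<close>, \<open>ut\<close> is the time derivative of \<open>u\<close>, in its
  representative that is continuous into \<open>H\<close>; \<open>utt\<close> is the time derivative of \<open>ut\<close>.
\<close>
definition energy_solution ::
    "'a::euclidean_space set \<Rightarrow> ('a \<Rightarrow> real) \<Rightarrow> (real \<Rightarrow> real) \<Rightarrow> ('a \<Rightarrow> real) \<Rightarrow> ('a \<Rightarrow> real) \<Rightarrow>
     real \<Rightarrow> (real \<Rightarrow> 'a \<Rightarrow> real) \<Rightarrow> (real \<Rightarrow> 'a \<Rightarrow> real) \<Rightarrow> bool" where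
  "energy_solution \<Omega> p g u0 u1 T u ut \<longleftrightarrow>
     0 < T \<and> u0 \<in> H01 \<Omega> \<and> u1 \<in> L2 \<Omega> \<and>
     continuous_into {0..T} (H01 \<Omega>) (Vnorm \<Omega>) u \<and>
     continuous_into {0..T} (L2 \<Omega>) (L2norm \<Omega>) ut \<and>
     square_integrable_into {0<..<T} (H01 \<Omega>) (Vnorm \<Omega>) ut \<and>
     weak_time_deriv T (L2 \<Omega>) (\<lambda>t. L2inner \<Omega> (u t)) (\<lambda>t. L2inner \<Omega> (ut t)) \<and>
     (AE x in lebesgue_on \<Omega>. u 0 x = u0 x) \<and>
     (AE x in lebesgue_on \<Omega>. ut 0 x = u1 x) \<and>
     (\<exists>utt :: real \<Rightarrow> ('a \<Rightarrow> real) \<Rightarrow> real.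
        square_integrable_into {0<..<T} (Vdual \<Omega>) (Vdual_norm \<Omega>) utt \<and>
        weak_time_deriv T (H01 \<Omega>) (\<lambda>t. L2inner \<Omega> (ut t)) utt \<and>
        (\<forall>z\<in>H01 \<Omega>. AE t in lebesgue_on {0<..<T}.
           utt t z + L2inner \<Omega> (wgrad \<Omega> (u t)) (wgrad \<Omega> z)
             + L2inner \<Omega> (wgrad \<Omega> (ut t)) (wgrad \<Omega> z)
             - (LINT s|lebesgue_on {0..t}. g (t - s) * L2inner \<Omega> (wgrad \<Omega> (u s)) (wgrad \<Omega> z))
           = (LINT x|lebesgue_on \<Omega>. source p x (u t x) * z x)))"


section \<open>Energies\<close>

definition memory_energy ::
    "'a::euclidean_space set \<Rightarrow> (real \<Rightarrow> real) \<Rightarrow> (real \<Rightarrow> 'a \<Rightarrow> real) \<Rightarrow> real \<Rightarrow> real" where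
  "memory_energy \<Omega> g u t =
     (LINT s|lebesgue_on {0..t}.
        g (t - s) * (L2norm \<Omega> (\<lambda>x. wgrad \<Omega> (u t) x - wgrad \<Omega> (u s) x))\<^sup>2)"

definition energy ::
    "'a::euclidean_space set \<Rightarrow> ('a \<Rightarrow> real) \<Rightarrow> (real \<Rightarrow> real) \<Rightarrow>
     (real \<Rightarrow> 'a \<Rightarrow> real) \<Rightarrow> (real \<Rightarrow> 'a \<Rightarrow> real) \<Rightarrow> real \<Rightarrow> real" where
  "energy \<Omega> p g u ut t =
     1/2 * (L2norm \<Omega> (ut t))\<^sup>2
     + 1/2 * (1 - (LINT s|lebesgue_on {0..t}. g s)) * (L2norm \<Omega> (wgrad \<Omega> (u t)))\<^sup>2
     + 1/2 * memory_energy \<Omega> g u t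
     - (LINT x|lebesgue_on \<Omega>. F_pot p x (u t x))"

definition C_star :: "'a::euclidean_space set \<Rightarrow> ('a \<Rightarrow> real) \<Rightarrow> real" where
  "C_star \<Omega> p = (LINT x|lebesgue_on \<Omega>. c_const (p_minus \<Omega> p) (p x))"

definition shifted_energy ::
    "'a::euclidean_space set \<Rightarrow> ('a \<Rightarrow> real) \<Rightarrow> (real \<Rightarrow> real) \<Rightarrow>
     (real \<Rightarrow> 'a \<Rightarrow> real) \<Rightarrow> (real \<Rightarrow> 'a \<Rightarrow> real) \<Rightarrow> real \<Rightarrow> real" where
  "shifted_energy \<Omega> p g u ut t = energy \<Omega> p g u ut t + C_star \<Omega> p / p_minus \<Omega> p"

end

theory Submission
  imports Defs "HOL-Real_Asymp.Real_Asymp"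
begin

text \<open>
  Write \<open>s = |r| > 0\<close>.  For \<open>q > p\<^sub>-\<close> the substitution \<open>y = q log s + p\<^sub>- / (q - p\<^sub>-)\<close> turns
  \<open>s\<^sup>q ((q - p\<^sub>-)/q log s + p\<^sub>-/q\<^sup>2)\<close> into a positive multiple of \<open>y e\<^sup>y\<close>, namely
  \<open>(q - p\<^sub>-)/q\<^sup>2 \<cdot> exp (- p\<^sub>- / (q - p\<^sub>-)) \<cdot> y e\<^sup>y\<close>.  The minimum of \<open>y e\<^sup>y\<close> is \<open>-1/e\<close>, at
  \<open>y = -1\<close>; this gives the bound and, since \<open>y = -1\<close> corresponds to \<open>s = exp (- 1 / (q - p\<^sub>-))\<close>,
  also its sharpness.  For \<open>q = p\<^sub>-\<close> the expression is nonnegative and the constant is \<open>0\<close>.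

  For the integral inequality, put \<open>A = |u|\<^sup>p log|u|\<close>.  All terms of the energy except the potential
  cancel, and what remains is \<open>\<integral> A \<ge> p\<^sub>- \<integral> F(x,u) - C\<^sub>*\<close>.  The pointwise bound at \<open>q = p(x)\<close>,
  \<open>r = u(x)\<close> says exactly that \<open>A - p\<^sub>- F(x,u) \<ge> - c(p(x))\<close>, so integrating it suffices when both functions
  are integrable (\<open>integral_logpower_ge\<close>).  Because \<open>p\<close> is bounded and \<open>\<Omega>\<close> has finite measure,
  \<open>A\<close> is integrable if and only if \<open>F(x,u)\<close> is (\<open>integrable_logpower_iff_F_pot\<close>): for \<open>|u|\<close> large
  they are comparable, for \<open>|u|\<close> small both are bounded.  If neither is integrable, both
  integrals are \<open>0\<close> by the convention for Bochner integrals, and the claim reduces to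
  \<open>C\<^sub>* \<ge> 0\<close>.
\<close>

section \<open>The pointwise bound and its sharpness\<close>

lemma c_const_nonneg:
  assumes "pm \<le> q"
  shows "0 \<le> c_const pm q"
  using assms by (auto simp: c_const_def)

lemma c_const_le_1:
  assumes "1 \<le> pm"
  shows "c_const pm q \<le> 1"
proof (cases "pm < q")
  case True
  have "(q - pm) / q\<^sup>2 * exp (- q / (q - pm)) \<le> 1 * 1"
  proof (rule mult_mono)
    have "q * 1 \<le> q * q"
      by (rule mult_left_mono) (use True assms in auto)
    then have "q - pm \<le> q\<^sup>2"
      using assms unfolding power2_eq_square by linarith
    then show "(q - pm) / q\<^sup>2 \<le> 1"
      using True assms by (simp add: divide_le_eq)
  qed (use True assms in auto)
  then show ?thesis
    using True by (simp add: c_const_def)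
qed (simp add: c_const_def)

text \<open>This is \<open>1 + z \<le> e\<^sup>z\<close> at \<open>z = - y - 1\<close>, multiplied by \<open>e\<^sup>y\<close>; equality holds at \<open>y = -1\<close>.\<close>
lemma mult_exp_ge: "- exp (- 1) \<le> y * exp y" for y :: real
proof -
  have "1 + (- y - 1) \<le> exp (- y - 1)"
    by (rule exp_ge_add_one_self)
  then have "- y * exp y \<le> exp (- y - 1) * exp y"
    by (intro mult_right_mono) auto
  also have "\<dots> = exp (- 1)"
    by (simp flip: exp_add)
  finally show ?thesis
    by simp
qed

lemma raw_expr_ge:
  assumes "0 < pm" "pm \<le> q" "r \<noteq> 0"
  shows "- c_const pm q \<le> raw_expr pm q r"
proof (cases "pm = q")
  case True
  then show ?thesis
    using assms by (simp add: c_const_def raw_expr_def)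
next
  case False
  define d where "d = q - pm"
  have d: "d > 0" "pm = q - d" "q > 0"
    using False assms by (auto simp: d_def)
  \<comment> \<open>the shift \<open>pm / d\<close> makes the bracket proportional to \<open>y\<close>, at the price of a constant factor
    in the power of \<open>\<bar>r\<bar>\<close>\<close>
  define y where "y = q * ln \<bar>r\<bar> + pm / d"
  define k where "k = d / q\<^sup>2 * exp (- pm / d)"
  have "k \<ge> 0"
    using d by (simp add: k_def)
  have "\<bar>r\<bar> powr q = exp (- pm / d) * exp y"
    using assms(3) by (simp add: powr_def y_def flip: exp_add)
  moreover have "(q - pm) / q * ln \<bar>r\<bar> + pm / q\<^sup>2 = d / q\<^sup>2 * y"
    using d(1,3) by (simp add: y_def d_def [symmetric] field_simps power2_eq_square)
  ultimately have "raw_expr pm q r = k * (y * exp y)"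
    by (simp add: raw_expr_def k_def)
  moreover have "c_const pm q = k * exp (- 1)"
  proof -
    have "- q / d = - pm / d + - 1"
      using d by (simp add: field_simps)
    then have "exp (- q / d) = exp (- pm / d) * exp (- 1)"
      by (metis exp_add)
    then show ?thesis
      using d(1) by (simp add: c_const_def k_def d_def)
  qed
  ultimately show ?thesis
    using mult_left_mono [OF mult_exp_ge [of y] \<open>k \<ge> 0\<close>] by simp
qed

text \<open>The point where \<open>y = -1\<close> in the substitution above.\<close>
lemma raw_expr_minimum:
  assumes "0 < pm" "pm < q"
  shows "raw_expr pm q (exp (- 1 / (q - pm))) = - c_const pm q"
proof -
  have "(q - pm) / q * (- 1 / (q - pm)) + pm / q\<^sup>2 = - ((q - pm) / q\<^sup>2)"
    using assms by (simp add: field_simps power2_eq_square)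
  moreover have "exp (- 1 / (q - pm)) powr q = exp (- q / (q - pm))"
    by (simp add: powr_def)
  ultimately show ?thesis
    using assms by (simp add: raw_expr_def c_const_def)
qed

lemma raw_expr_tendsto_0:
  assumes "0 < q"
  shows "(raw_expr pm q \<longlongrightarrow> 0) (at 0)"
proof -
  have "((\<lambda>s::real. s powr q * ((q - pm) / q * ln s + pm / q\<^sup>2)) \<longlongrightarrow> 0) (at_right 0)"
    using assms by real_asymp
  moreover have "filterlim (\<lambda>r::real. \<bar>r\<bar>) (at_right 0) (at 0)"
    unfolding filterlim_at
    by (auto simp: eventually_at_filter intro!: tendsto_eq_intros)
  ultimately show ?thesis
    unfolding raw_expr_def by (rule filterlim_compose)
qed

lemma lower_expr_0: "0 < q \<Longrightarrow> lower_expr pm q 0 = 0"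
  using tendsto_Lim [OF _ raw_expr_tendsto_0, of q pm] by (simp add: lower_expr_def)

lemma lower_expr_ge:
  assumes "0 < pm" "pm \<le> q"
  shows "- c_const pm q \<le> lower_expr pm q r"
proof (cases "r = 0")
  case True
  then show ?thesis
    using assms lower_expr_0 [of q pm] c_const_nonneg [of pm q] by simp
next
  case False
  then show ?thesis
    using assms raw_expr_ge [of pm q r] by (simp add: lower_expr_def)
qed

lemma c_const_least:
  assumes "0 < pm" "pm \<le> q" "0 \<le> c" "\<And>r. - c \<le> lower_expr pm q r"
  shows "c_const pm q \<le> c"
proof (cases "pm = q")
  case True
  then show ?thesis
    using assms by (simp add: c_const_def)
next
  case False
  then show ?thesis
    using assms(1,2) assms(4) [of "exp (- 1 / (q - pm))"] raw_expr_minimum [of pm q]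
    by (simp add: lower_expr_def)
qed

section \<open>Integrability and the integrated bound\<close>

text \<open>
  The lower bound of the logarithmic integrand by the potential, in the form in which it is
  integrated.  At \<open>r = 0\<close> both powers vanish.
\<close>
lemma logpower_ge_F_pot:
  assumes "0 < pm" "pm \<le> p x"
  shows "pm * F_pot p x r - c_const pm (p x) \<le> \<bar>r\<bar> powr p x * ln \<bar>r\<bar>"
proof (cases "r = 0")
  case True
  then show ?thesis
    using c_const_nonneg [OF assms(2)] by (simp add: F_pot_def)
next
  case False
  have "raw_expr pm (p x) r = \<bar>r\<bar> powr p x * ln \<bar>r\<bar> - pm * F_pot p x r"
    using assms by (simp add: raw_expr_def F_pot_def field_simps power2_eq_square)
  then show ?thesis
    using raw_expr_ge [OF assms False] by simp
qed

lemma abs_logpower_le_near_0: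
  fixes s q :: real
  assumes "0 \<le> s" "s \<le> 1" "1 \<le> q"
  shows "\<bar>s powr q * ln s\<bar> \<le> 1"
proof (cases "s = 0")
  case False
  then have s: "0 < s"
    using assms by simp
  have "- ln s \<le> 1 / s - 1"
    using ln_le_minus_one [of "1 / s"] s by (simp add: ln_div)
  then have "s * - ln s \<le> s * (1 / s - 1)"
    using s by (intro mult_left_mono) auto
  also have "\<dots> \<le> 1"
    using s by (simp add: algebra_simps)
  finally have "s * - ln s \<le> 1" .
  moreover have "s powr q * - ln s \<le> s * - ln s"
    using powr_mono' [of 1 q s] assms s by (intro mult_right_mono) auto
  moreover have "s powr q * ln s \<le> 0"
    using assms s by (intro mult_nonneg_nonpos) auto
  ultimately show ?thesis
    by linarith
qed auto

text \<open>The threshold \<open>|r| = e\<close> is where \<open>log|r| = 1\<close>, so that beyond it \<open>|r|\<^sup>p\<close> is below \<open>|r|\<^sup>p log|r|\<close>.\<close>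
lemma power_le_logpower:
  fixes r q P :: real
  assumes "0 \<le> q" "q \<le> P"
  shows "\<bar>r\<bar> powr q \<le> \<bar>\<bar>r\<bar> powr q * ln \<bar>r\<bar>\<bar> + exp P"
proof (cases "\<bar>r\<bar> \<le> exp 1")
  case True
  have "\<bar>r\<bar> powr q \<le> exp 1 powr q"
    using True assms by (intro powr_mono2) auto
  also have "\<dots> \<le> exp P"
    using assms by (simp add: powr_def)
  finally show ?thesis
    by simp
next
  case False
  then have "1 \<le> ln \<bar>r\<bar>"
    by (subst ln_ge_iff) (use less_trans [OF exp_gt_zero, of 1 "\<bar>r\<bar>"] in auto)
  then have "\<bar>r\<bar> powr q * 1 \<le> \<bar>r\<bar> powr q * ln \<bar>r\<bar>"
    by (intro mult_left_mono) auto
  then show ?thesis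
    by (smt (verit) exp_gt_zero)
qed

lemma abs_F_pot_le:
  assumes "2 < p x" "p x \<le> P"
  shows "\<bar>F_pot p x r\<bar> \<le> 2 * \<bar>\<bar>r\<bar> powr p x * ln \<bar>r\<bar>\<bar> + exp P"
proof -
  let ?A = "\<bar>r\<bar> powr p x * ln \<bar>r\<bar>" and ?B = "\<bar>r\<bar> powr p x"
  have sq: "1 \<le> (p x)\<^sup>2"
    using assms by (simp add: power2_eq_square) (smt (verit) mult_le_cancel_left1)
  have "\<bar>F_pot p x r\<bar> \<le> \<bar>?A / p x\<bar> + \<bar>?B / (p x)\<^sup>2\<bar>"
    unfolding F_pot_def using abs_triangle_ineq4 [of "?A / p x" "?B / (p x)\<^sup>2"] by simp
  moreover have "\<bar>?A / p x\<bar> \<le> \<bar>?A\<bar>"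
    using assms by (simp add: abs_divide divide_le_eq) (smt (verit) mult_left_mono abs_ge_zero mult_cancel_left1)
  moreover have "\<bar>?B / (p x)\<^sup>2\<bar> \<le> ?B"
    using sq mult_left_mono [OF sq, of ?B] by (simp add: abs_divide divide_le_eq)
  moreover have "?B \<le> \<bar>?A\<bar> + exp P"
    using assms by (intro power_le_logpower) auto
  ultimately show ?thesis
    by linarith
qed

text \<open>
  For \<open>|r| > e\<close> one has \<open>1/p \<le> 1/2 \<le> \<onehalf> log|r|\<close>, so that the potential is at least half of its
  logarithmic part.  The remaining range of \<open>r\<close> gives the additive constant.
\<close>
lemma abs_logpower_le_F_pot:
  assumes "2 < p x" "p x \<le> P"
  shows "\<bar>\<bar>r\<bar> powr p x * ln \<bar>r\<bar>\<bar> \<le> 2 * P * \<bar>F_pot p x r\<bar> + (exp P + 1)"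
proof -
  let ?A = "\<bar>r\<bar> powr p x * ln \<bar>r\<bar>"
  have nn: "0 \<le> 2 * P * \<bar>F_pot p x r\<bar>"
    using assms by simp
  consider "\<bar>r\<bar> \<le> 1" | "1 < \<bar>r\<bar>" "\<bar>r\<bar> \<le> exp 1" | "exp 1 < \<bar>r\<bar>"
    by linarith
  then show ?thesis
  proof cases
    case 1
    then have "\<bar>?A\<bar> \<le> 1"
      using assms by (intro abs_logpower_le_near_0) auto
    then show ?thesis
      using nn exp_gt_zero [of P] by linarith
  next
    case 2
    have "0 \<le> ln \<bar>r\<bar>"
      using 2 by simp
    moreover have "ln \<bar>r\<bar> \<le> 1"
      using 2 ln_le_cancel_iff [of "\<bar>r\<bar>" "exp 1"] by simp
    moreover have "\<bar>r\<bar> powr p x \<le> exp 1 powr p x"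
      using 2 assms by (intro powr_mono2) auto
    moreover have "exp 1 powr p x \<le> exp P"
      using assms by (simp add: powr_def)
    ultimately have "\<bar>?A\<bar> \<le> exp P * 1"
      unfolding abs_mult by (intro mult_mono) auto
    then show ?thesis
      using nn by simp
  next
    case 3
    then have "1 \<le> ln \<bar>r\<bar>"
      by (subst ln_ge_iff) (use less_trans [OF exp_gt_zero, of 1 "\<bar>r\<bar>"] in auto)
    moreover have "1 / p x \<le> 1 / 2"
      using assms by (simp add: field_simps)
    ultimately have half: "ln \<bar>r\<bar> / 2 \<le> ln \<bar>r\<bar> - 1 / p x" and A: "0 \<le> ?A"
      by auto
    have "?A = 2 * (\<bar>r\<bar> powr p x * (ln \<bar>r\<bar> / 2))"
      by simp
    also have "\<dots> \<le> 2 * (\<bar>r\<bar> powr p x * (ln \<bar>r\<bar> - 1 / p x))"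
      using half by (intro mult_left_mono) auto
    also have "\<dots> = 2 * p x * F_pot p x r"
      using assms by (simp add: F_pot_def field_simps power2_eq_square)
    also have "\<dots> \<le> 2 * p x * \<bar>F_pot p x r\<bar>"
      using assms by (intro mult_left_mono) auto
    also have "\<dots> \<le> 2 * P * \<bar>F_pot p x r\<bar>"
      using assms by (intro mult_right_mono) auto
    finally show ?thesis
      using A exp_gt_zero [of P] by linarith
  qed
qed

context finite_measure
begin

text \<open>
  Boundedness of \<open>p\<close> makes each function bounded by an affine function of the absolute value of
  the other, and constants are integrable because the measure is finite.
\<close>
lemma integrable_logpower_iff_F_pot:
  fixes p v :: "'a \<Rightarrow> real"
  assumes [measurable]: "p \<in> borel_measurable M" "v \<in> borel_measurable M"
    and p: "AE x in M. 2 < p x \<and> p x \<le> P"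
  shows "integrable M (\<lambda>x. \<bar>v x\<bar> powr p x * ln \<bar>v x\<bar>) \<longleftrightarrow> integrable M (\<lambda>x. F_pot p x (v x))"
    (is "integrable M ?A \<longleftrightarrow> integrable M ?F")
proof
  have [measurable]: "?F \<in> borel_measurable M"
    unfolding F_pot_def by measurable
  show "integrable M ?F" if "integrable M ?A"
  proof (rule Bochner_Integration.integrable_bound)
    show "integrable M (\<lambda>x. 2 * \<bar>?A x\<bar> + exp P)"
      using that by simp
    show "AE x in M. norm (?F x) \<le> norm (2 * \<bar>?A x\<bar> + exp P)"
      using p by eventually_elim (use abs_F_pot_le in fastforce)
  qed measurable
  show "integrable M ?A" if "integrable M ?F"
  proof (rule Bochner_Integration.integrable_bound)
    show "integrable M (\<lambda>x. 2 * P * \<bar>?F x\<bar> + (exp P + 1))"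
      using that by simp
    show "AE x in M. norm (?A x) \<le> norm (2 * P * \<bar>?F x\<bar> + (exp P + 1))"
      using p by eventually_elim (use abs_logpower_le_F_pot in \<open>force intro: order_trans\<close>)
  qed measurable
qed

lemma integral_logpower_ge:
  fixes p v :: "'a \<Rightarrow> real"
  assumes [measurable]: "p \<in> borel_measurable M" "v \<in> borel_measurable M"
    and pm: "2 < pm" and p: "AE x in M. pm \<le> p x \<and> p x \<le> P"
  shows "pm * (LINT x|M. F_pot p x (v x)) - (LINT x|M. c_const pm (p x))
    \<le> (LINT x|M. \<bar>v x\<bar> powr p x * ln \<bar>v x\<bar>)"
    (is "pm * integral\<^sup>L M ?F - integral\<^sup>L M ?c \<le> integral\<^sup>L M ?A")
proof (cases "integrable M ?A")
  case True
  have "AE x in M. 2 < p x \<and> p x \<le> P"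
    using p by eventually_elim (use pm in auto)
  then have F: "integrable M ?F"
    using True integrable_logpower_iff_F_pot [of p v P] by simp
  have [measurable]: "?c \<in> borel_measurable M"
    unfolding c_const_def by measurable
  have c: "integrable M ?c"
  proof (rule integrable_const_bound)
    show "AE x in M. norm (?c x) \<le> 1"
      using p by eventually_elim (use pm c_const_le_1 [of pm] c_const_nonneg [of pm] in auto)
  qed measurable
  have "pm * integral\<^sup>L M ?F - integral\<^sup>L M ?c = (LINT x|M. pm * ?F x - ?c x)"
    using F c by simp
  also have "\<dots> \<le> integral\<^sup>L M ?A"
  proof (rule integral_mono_AE)
    show "AE x in M. pm * ?F x - ?c x \<le> ?A x"
      using p by eventually_elim (use pm logpower_ge_F_pot [of pm p] in auto)
  qed (use True F c in auto)
  finally show ?thesis .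
next
  case False
  have "AE x in M. 2 < p x \<and> p x \<le> P"
    using p by eventually_elim (use pm in auto)
  then have "\<not> integrable M ?F"
    using False integrable_logpower_iff_F_pot [of p v P] by simp
  \<comment> \<open>both integrals now have the default value 0\<close>
  moreover have "0 \<le> integral\<^sup>L M ?c"
    by (rule integral_nonneg_AE) (use p c_const_nonneg in auto)
  ultimately show ?thesis
    using False by (simp add: not_integrable_integral_eq)
qed

end

section \<open>Energy solutions\<close>

text \<open>
  A nonempty open set is not null, so some value \<open>p(x)\<close> lies between the essential bounds.  This
  excludes \<open>\<infinity>\<close> for the lower and \<open>-\<infinity>\<close> for the upper one, the values they would take on a null set.
\<close>
lemma exponent_hyp_bounds:
  fixes \<Omega> :: "'a::euclidean_space set"
  assumes \<Omega>: "open \<Omega>" "\<Omega> \<noteq> {}" and p: "exponent_hyp \<Omega> p"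
  obtains P where "2 < p_minus \<Omega> p" "AE x in lebesgue_on \<Omega>. p_minus \<Omega> p \<le> p x \<and> p x \<le> P"
proof -
  let ?M = "lebesgue_on \<Omega>"
  let ?i = "essinf ?M (\<lambda>x. ereal (p x))" and ?s = "esssup ?M (\<lambda>x. ereal (p x))"
  have ae: "AE x in ?M. ?i \<le> ereal (p x) \<and> ereal (p x) \<le> ?s"
    and i2: "2 < ?i" and s: "?s < sobolev_critical DIM('a)"
    using p by (auto simp: exponent_hyp_def)
  have "\<not> (AE x in ?M. False)"
  proof
    assume "AE x in ?M. False"
    then have "AE x in lebesgue. x \<notin> \<Omega>"
      using \<Omega> by (simp add: AE_restrict_space_iff)
    then have "negligible \<Omega>"
      using \<Omega>(1) by (simp add: negligible_iff_null_sets AE_iff_null_sets)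
    then show False
      using open_not_negligible \<Omega> by blast
  qed
  then obtain x0 where x0: "?i \<le> ereal (p x0)" "ereal (p x0) \<le> ?s"
    using eventually_happens [OF ae] by (auto simp: trivial_limit_def)
  have i: "?i = ereal (p_minus \<Omega> p)"
    unfolding p_minus_def using i2 x0 by (cases ?i) auto
  have "?s = ereal (real_of_ereal ?s)"
    using s x0 by (cases ?s) auto
  then obtain P where P: "?s = ereal P" ..
  show thesis
  proof
    show "2 < p_minus \<Omega> p"
      using i2 unfolding i by simp
    show "AE x in ?M. p_minus \<Omega> p \<le> p x \<and> p x \<le> P"
      using ae unfolding i P by simp
  qed
qed

lemma energy_solution_measurable:
  assumes "energy_solution \<Omega> p g u0 u1 T u ut" "t \<in> {0..T}"
  shows "u t \<in> borel_measurable (lebesgue_on \<Omega>)"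
  using assms
  by (auto simp: energy_solution_def continuous_into_def H01_def H1_def L2_def)

lemma logpower_ge_shifted_energy:
  fixes \<Omega> :: "'a::euclidean_space set"
  assumes \<Omega>: "smooth_bounded_domain \<Omega>" and p: "exponent_hyp \<Omega> p"
    and u: "u t \<in> borel_measurable (lebesgue_on \<Omega>)"
  shows "p_minus \<Omega> p / 2 * (L2norm \<Omega> (ut t))\<^sup>2
      + p_minus \<Omega> p / 2 * (1 - (LINT s|lebesgue_on {0..t}. g s)) * (L2norm \<Omega> (wgrad \<Omega> (u t)))\<^sup>2
      + p_minus \<Omega> p / 2 * memory_energy \<Omega> g u t
      - p_minus \<Omega> p * shifted_energy \<Omega> p g u ut t
    \<le> (LINT x|lebesgue_on \<Omega>. \<bar>u t x\<bar> powr p x * ln \<bar>u t x\<bar>)"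
    (is "?lhs \<le> ?rhs")
proof -
  have dom: "open \<Omega>" "\<Omega> \<noteq> {}" "bounded \<Omega>"
    using \<Omega> by (auto simp: smooth_bounded_domain_def)
  obtain P where pm: "2 < p_minus \<Omega> p"
    and bounds: "AE x in lebesgue_on \<Omega>. p_minus \<Omega> p \<le> p x \<and> p x \<le> P"
    using exponent_hyp_bounds [OF dom(1,2) p] .
  have "\<Omega> \<in> lmeasurable"
    using dom by (intro lmeasurable_open)
  then interpret finite_measure "lebesgue_on \<Omega>"
    by (rule finite_measure_lebesgue_on)
  have "p \<in> borel_measurable (lebesgue_on \<Omega>)"
    using p by (simp add: exponent_hyp_def)
  from integral_logpower_ge [OF this u pm bounds]
  have "p_minus \<Omega> p * (LINT x|lebesgue_on \<Omega>. F_pot p x (u t x)) - C_star \<Omega> p \<le> ?rhs"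
    by (simp add: C_star_def)
  moreover have "?lhs = p_minus \<Omega> p * (LINT x|lebesgue_on \<Omega>. F_pot p x (u t x)) - C_star \<Omega> p"
    using pm by (simp add: shifted_energy_def energy_def field_simps)
  ultimately show ?thesis
    by simp
qed

theorem lemma3p1:
  shows "(\<forall>pm q r :: real. 2 < pm \<and> pm \<le> q \<longrightarrow> lower_expr pm q r \<ge> - c_const pm q) \<and>
    (\<forall>pm q :: real. 2 < pm \<and> pm \<le> q \<longrightarrow>
       c_const pm q \<ge> 0 \<and>
       (\<forall>c\<ge>0. (\<forall>r::real. lower_expr pm q r \<ge> - c) \<longrightarrow> c_const pm q \<le> c)) \<and>
    (\<forall>(\<Omega> :: (real ^ 'n) set) (p :: real ^ 'n \<Rightarrow> real) (g :: real \<Rightarrow> real) u0 u1 T u ut.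
       smooth_bounded_domain \<Omega> \<and> exponent_hyp \<Omega> p \<and> kernel_hyp g \<and>
       energy_solution \<Omega> p g u0 u1 T u ut \<longrightarrow>
       (\<forall>t\<in>{0..T}.
          (LINT x|lebesgue_on \<Omega>. \<bar>u t x\<bar> powr p x * ln \<bar>u t x\<bar>)
          \<ge> p_minus \<Omega> p / 2 * (L2norm \<Omega> (ut t))\<^sup>2
            + p_minus \<Omega> p / 2 * (1 - (LINT s|lebesgue_on {0..t}. g s))
                * (L2norm \<Omega> (wgrad \<Omega> (u t)))\<^sup>2
            + p_minus \<Omega> p / 2 * memory_energy \<Omega> g u t
            - p_minus \<Omega> p * shifted_energy \<Omega> p g u ut t))"
proof (intro conjI allI impI ballI)
  show "lower_expr pm q r \<ge> - c_const pm q" if "2 < pm \<and> pm \<le> q" for pm q r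
    using that lower_expr_ge by simp
  show "c_const pm q \<ge> 0" if "2 < pm \<and> pm \<le> q" for pm q
    using that c_const_nonneg by simp
  show "c_const pm q \<le> c"
    if "2 < pm \<and> pm \<le> q" "c \<ge> 0" "\<forall>r. lower_expr pm q r \<ge> - c" for pm q c
    using that c_const_least by simp
qed (blast intro: logpower_ge_shifted_energy energy_solution_measurable)

end
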